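(* Let $k$ and $n$ be positive integers. Then $$c\phi_k(n)=\sum_{\ell\mid k}\overline{c\phi}_\ell\Big(\frac{n}{k/\ell}\Big)=\sum_{\ell\mid k}\overline{c\phi}_{k/\ell}\Big(\frac n\ell\Big).$$
   Context: A $k$-colored generalized Frobenius symbol is a two-row array with $d\ge 0$ columns whose entries are colored nonnegative integers $z_c$ ($z\ge 0$, color $c\in\{1,\dots,k\}$), each row strictly decreasing with respect to the total order $0_1\prec 0_2\prec\cdots\prec 0_k\prec 1_1\prec\cdots\prec 1_k\prec 2_1\prec\cdots$; it is a symbol of $n=d+\sum(\text{integer values of all entries})$, and $c\phi_k(n)$ is the number of such symbols of $n$. Let $\sigma_k=(1\,2\,\cdots\,k)$ act on colors. The order of a symbol $\lambda$ is the smallest positive integer $\ell$ such that replacing every color $c$ in $\lambda$ by $\sigma_k^\ell(c)$ (keeping the integer values) and then re-sorting each row into strictly decreasing order with respect to $\prec$ gives back $\lambda$. $\overline{c\phi}_k(n)$ denotes the number of $k$-colored generalized Frobenius symbols of $n$ of order $k$. By convention $c\phi_k(x)=\overline{c\phi}_k(x)=0$ if $x$ is not an integer. *)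

theory Defs
  imports Complex_Main "HOL-Library.Product_Lexorder" "HOL-Combinatorics.Cycles"
begin

text \<open>The colored integer \<open>z\<^sub>c\<close> is the pair \<open>(z, c)\<close>, so that the lexicographic order
  on pairs is exactly \<open>0\<^sub>1 \<prec> 0\<^sub>2 \<prec> \<dots> \<prec> 0\<^sub>k \<prec> 1\<^sub>1 \<prec> \<dots>\<close>.\<close>

type_synonym colored_int = "nat \<times> nat"
type_synonym symbol = "colored_int list \<times> colored_int list"

definition frobenius_row :: "nat \<Rightarrow> colored_int list \<Rightarrow> bool" where
  "frobenius_row k r \<longleftrightarrow> (\<forall>(z, c) \<in> set r. 1 \<le> c \<and> c \<le> k) \<and> sorted_wrt (>) r"

definition frobenius_symbol :: "nat \<Rightarrow> symbol \<Rightarrow> bool" where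
  "frobenius_symbol k s \<longleftrightarrow>
     frobenius_row k (fst s) \<and> frobenius_row k (snd s) \<and> length (fst s) = length (snd s)"

definition symbol_weight :: "symbol \<Rightarrow> nat" where
  "symbol_weight s = length (fst s) + sum_list (map fst (fst s)) + sum_list (map fst (snd s))"

definition sigma :: "nat \<Rightarrow> nat \<Rightarrow> nat" where
  "sigma k = cycle_of_list [1..<Suc k]"

definition recolor_row :: "nat \<Rightarrow> nat \<Rightarrow> colored_int list \<Rightarrow> colored_int list" where
  "recolor_row k l r = rev (sort (map (\<lambda>(z, c). (z, (sigma k ^^ l) c)) r))"

definition recolor :: "nat \<Rightarrow> nat \<Rightarrow> symbol \<Rightarrow> symbol" where
  "recolor k l s = (recolor_row k l (fst s), recolor_row k l (snd s))"

definition symbol_order :: "nat \<Rightarrow> symbol \<Rightarrow> nat" where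
  "symbol_order k s = (LEAST l. 0 < l \<and> recolor k l s = s)"

text \<open>The counting functions take a rational argument: no symbol has a non-integral weight,
  so both vanish off the integers, as the convention requires.\<close>

definition cphi :: "nat \<Rightarrow> rat \<Rightarrow> nat" where
  "cphi k x = card {s. frobenius_symbol k s \<and> of_nat (symbol_weight s) = x}"

definition cphi_bar :: "nat \<Rightarrow> rat \<Rightarrow> nat" where
  "cphi_bar k x =
     card {s. frobenius_symbol k s \<and> of_nat (symbol_weight s) = x \<and> symbol_order k s = k}"

lemma sigma_apply: "sigma k c = (if 1 \<le> c \<and> c < k then Suc c else if c = k \<and> 1 \<le> k then 1 else c)"
proof -
  have gen: "cycle_of_list [a..<Suc (a + m)] c =
      (if a \<le> c \<and> c < a + m then Suc c else if c = a + m then a else c)" for a m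
  proof (induction m arbitrary: a)
    case 0
    then show ?case by simp
  next
    case (Suc m)
    have "[a..<Suc (a + Suc m)] = a # Suc a # [Suc (Suc a)..<Suc (Suc a + m)]"
      by (simp add: upt_rec)
    moreover have "Suc a # [Suc (Suc a)..<Suc (Suc a + m)] = [Suc a..<Suc (Suc a + m)]"
      by (simp add: upt_rec)
    ultimately have "cycle_of_list [a..<Suc (a + Suc m)] c =
        transpose a (Suc a) (cycle_of_list [Suc a..<Suc (Suc a + m)] c)"
      by (metis comp_apply cycle_of_list.simps(1))
    then show ?case
      unfolding Suc.IH by (auto simp: transpose_def)
  qed
  show ?thesis
  proof (cases k)
    case 0
    then show ?thesis by (simp add: sigma_def)
  next
    case (Suc m)
    then show ?thesis using gen[of 1 m] by (simp add: sigma_def)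
  qed
qed

lemma finite_symbols: "finite {s. frobenius_symbol k s \<and> of_nat (symbol_weight s) = (x::rat)}"
proof (cases "\<exists>n. x = of_nat n")
  case True
  then obtain n where n: "x = of_nat n" by blast
  let ?R = "{r :: colored_int list. set r \<subseteq> {..n} \<times> {..k} \<and> length r \<le> n}"
  have row: "r \<in> ?R"
    if "frobenius_row k r" "length r \<le> n" "sum_list (map fst r) \<le> n" for r
  proof -
    have "fst p \<le> n" if "p \<in> set r" for p
      using member_le_sum_list[of "fst p" "map fst r"] that \<open>sum_list (map fst r) \<le> n\<close> by force
    then show ?thesis using that(1,2) by (fastforce simp: frobenius_row_def)
  qed
  have "{s. frobenius_symbol k s \<and> of_nat (symbol_weight s) = x} \<subseteq> ?R \<times> ?R"
  proof
    fix s assume "s \<in> {s. frobenius_symbol k s \<and> of_nat (symbol_weight s) = x}"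
    then have f: "frobenius_symbol k s" and w: "symbol_weight s = n" by (auto simp: n)
    have "fst s \<in> ?R" by (rule row) (use f w in \<open>auto simp: frobenius_symbol_def symbol_weight_def\<close>)
    moreover have "snd s \<in> ?R"
      by (rule row) (use f w in \<open>auto simp: frobenius_symbol_def symbol_weight_def\<close>)
    ultimately show "s \<in> ?R \<times> ?R" by (simp add: mem_Times_iff)
  qed
  moreover have "finite (?R \<times> ?R)" by (intro finite_cartesian_product finite_lists_length_le) auto
  ultimately show ?thesis by (rule finite_subset)
next
  case False
  then have "{s. frobenius_symbol k s \<and> of_nat (symbol_weight s) = x} = {}" by auto
  then show ?thesis by (simp only: finite.emptyI)
qed

end

theory Submission
  imports Defs
begin

text \<open>Colors are read modulo \<open>k\<close>, so that a row becomes a \<open>k\<close>-periodic set of pairs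
  \<open>(z, i)\<close> with \<open>i\<close> ranging over all natural numbers (color \<open>c\<close> sits at
  \<open>i \<equiv> c - 1\<close>). Recoloring by \<open>\<sigma>\<^sub>k ^ m\<close> is then a translation by \<open>m\<close>, and the order of a
  symbol is the least common period of its two rows: a quantity that divides \<open>k\<close> and no longer
  refers to \<open>k\<close>. A symbol of order \<open>l\<close> can therefore be read equally well with \<open>l\<close> colors, which
  divides its weight by \<open>k / l\<close>; sorting the \<open>k\<close>-colored symbols by their order gives the
  identity.\<close>

definition unroll :: "nat \<Rightarrow> colored_int list \<Rightarrow> (nat \<times> nat) set" where
  "unroll k r = {(z, i). (z, Suc (i mod k)) \<in> set r}"

text \<open>Every set has period 0, so only positive periods carry information. The equivalence lets
  membership be transported both ways using forward shifts alone.\<close>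

definition period :: "nat \<Rightarrow> (nat \<times> nat) set \<Rightarrow> bool" where
  "period m E \<longleftrightarrow> (\<forall>z i. (z, i + m) \<in> E \<longleftrightarrow> (z, i) \<in> E)"

text \<open>Meant for \<open>l dvd k\<close>: the block of colors 1 to \<open>l\<close> is repeated
  \<open>k div l\<close> times, the copy number \<open>q\<close> being shifted by
  \<open>q * l\<close>. This is the \<open>k\<close>-colored row with the same unrolled set.\<close>

definition lift_row :: "nat \<Rightarrow> nat \<Rightarrow> colored_int list \<Rightarrow> colored_int list" where
  "lift_row k l r =
     rev (sorted_list_of_set ((\<lambda>((z, c), q). (z, c + q * l)) ` (set r \<times> {..<k div l})))"

definition lift_symbol :: "nat \<Rightarrow> nat \<Rightarrow> symbol \<Rightarrow> symbol" where
  "lift_symbol k l s = (lift_row k l (fst s), lift_row k l (snd s))"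

section \<open>Rows and their unrolled sets\<close>

lemma mem_unroll [simp]: "(z, i) \<in> unroll k r \<longleftrightarrow> (z, Suc (i mod k)) \<in> set r"
  by (simp add: unroll_def)

lemma frobenius_row_distinct: "frobenius_row k r \<Longrightarrow> distinct r"
  unfolding frobenius_row_def by (metis distinct_rev sorted_wrt_rev strict_sorted_iff)

lemma frobenius_row_color: "frobenius_row k r \<Longrightarrow> (z, c) \<in> set r \<Longrightarrow> 1 \<le> c \<and> c \<le> k"
  by (auto simp: frobenius_row_def)

lemma frobenius_row_eqI:
  assumes "frobenius_row k r" "frobenius_row l r'" "set r = set r'"
  shows "r = r'"
proof -
  have "sorted_wrt (<) (rev r)" "sorted_wrt (<) (rev r')"
    using assms by (auto simp: frobenius_row_def sorted_wrt_rev)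
  then have "rev r = rev r'"
    using assms(3) by (intro strict_sorted_equal) auto
  then show ?thesis by simp
qed

text \<open>Colors lie between 1 and \<open>k\<close>, so the index \<open>c - 1\<close> is its own
  residue modulo \<open>k\<close> and recovers the entry; the order of a row is forced by its
  set.\<close>

lemma frobenius_row_unroll_eqI:
  assumes "frobenius_row k r" "frobenius_row k r'" "unroll k r = unroll k r'"
  shows "r = r'"
proof (rule frobenius_row_eqI[OF assms(1,2)])
  have *: "(z, c) \<in> set q \<longleftrightarrow> 1 \<le> c \<and> c \<le> k \<and> (z, c - 1) \<in> unroll k q"
    if "frobenius_row k q" for z c q
    using frobenius_row_color[OF that, of z c] by auto
  show "set r = set r'"
    unfolding set_eq_iff split_paired_All *[OF assms(1)] *[OF assms(2)] assms(3) by blast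
qed

section \<open>Recoloring as translation\<close>

lemma inj_sigma: "inj (sigma k)"
  using cycle_permutes[of "[1..<Suc k]"] permutes_inj unfolding sigma_def by blast

lemma sigma_funpow:
  assumes "k > 0"
  shows "(sigma k ^^ m) (Suc (i mod k)) = Suc ((i + m) mod k)"
proof (induction m)
  case (Suc m)
  have "sigma k (Suc (j mod k)) = Suc (Suc j mod k)" for j
    using mod_less_divisor[OF assms, of j] by (simp add: sigma_apply mod_Suc)
  with Suc show ?case by simp
qed simp

lemma color_eq_Suc_mod:
  assumes "1 \<le> c" "c \<le> (k::nat)"
  shows "\<exists>i. c = Suc (i mod k)"
  using assms by (intro exI[of _ "c - 1"]) simp

lemma frobenius_row_recolor_row:
  assumes "k > 0" "frobenius_row k r"
  shows "frobenius_row k (recolor_row k m r)"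
proof -
  have "inj (sigma k ^^ m)"
    using inj_sigma by (rule inj_fn)
  then have "inj_on (\<lambda>(z, c). (z, (sigma k ^^ m) c)) (set r)"
    by (auto simp: inj_on_def)
  then have "sorted_wrt (>) (recolor_row k m r)"
    using frobenius_row_distinct[OF assms(2)]
    by (simp add: recolor_row_def sorted_wrt_rev strict_sorted_iff distinct_map)
  moreover have "1 \<le> (sigma k ^^ m) c \<and> (sigma k ^^ m) c \<le> k" if "(z, c) \<in> set r" for z c
    using color_eq_Suc_mod[of c k] frobenius_row_color[OF assms(2) that] assms(1)
    by (auto simp: sigma_funpow Suc_le_eq)
  ultimately show ?thesis
    by (fastforce simp: frobenius_row_def recolor_row_def)
qed

text \<open>The color at index \<open>i\<close> moves to index \<open>i + m\<close>; by injectivity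
  of the power of \<open>sigma k\<close>, no other color lands there.\<close>

lemma unroll_recolor_row:
  assumes "k > 0" "frobenius_row k r"
  shows "(z, i + m) \<in> unroll k (recolor_row k m r) \<longleftrightarrow> (z, i) \<in> unroll k r"
  using inj_eq[OF inj_fn[OF inj_sigma, of m]]
  by (force simp: recolor_row_def sigma_funpow[OF assms(1), symmetric])

lemma recolor_row_fixed_iff:
  assumes "k > 0" "frobenius_row k r"
  shows "recolor_row k m r = r \<longleftrightarrow> period m (unroll k r)"
proof
  assume "recolor_row k m r = r"
  then show "period m (unroll k r)"
    using unroll_recolor_row[OF assms, of _ _ m] by (simp add: period_def)
next
  assume p: "period m (unroll k r)"
  have "(z, i) \<in> unroll k (recolor_row k m r) \<longleftrightarrow> (z, i) \<in> unroll k r" for z i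
  proof -
    \<comment> \<open>\<open>j + m\<close> is congruent to \<open>i\<close> modulo \<open>k\<close>; the multiple of \<open>k\<close> avoids negative indices.\<close>
    define j where "j = i + (k * m - m)"
    have "m \<le> k * m" using assms(1) by simp
    then have "j + m = i + k * m"
      unfolding j_def by linarith
    then have "(j + m) mod k = i mod k"
      by simp
    then have "(z, i) \<in> unroll k q \<longleftrightarrow> (z, j + m) \<in> unroll k q" for q
      by (simp add: unroll_def)
    then show ?thesis
      using unroll_recolor_row[OF assms] p by (simp only: period_def)
  qed
  then show "recolor_row k m r = r"
    by (intro frobenius_row_unroll_eqI[OF frobenius_row_recolor_row[OF assms] assms(2)]) auto
qed

text \<open>On the right, \<open>k\<close> enters only through the unrolled sets. This makes orders
  comparable across different numbers of colors.\<close>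

lemma symbol_order_eq:
  assumes "k > 0" "frobenius_symbol k s"
  shows "symbol_order k s =
    (LEAST m. 0 < m \<and> period m (unroll k (fst s)) \<and> period m (unroll k (snd s)))"
proof -
  have "frobenius_row k (fst s)" "frobenius_row k (snd s)"
    using assms(2) by (auto simp: frobenius_symbol_def)
  then show ?thesis
    by (simp add: symbol_order_def recolor_def prod_eq_iff recolor_row_fixed_iff[OF assms(1)])
qed

section \<open>Periods and divisibility of the order\<close>

lemma period_unroll: "period k (unroll k r)"
  by (simp add: period_def)

lemma period_mult:
  assumes "period m E"
  shows "period (q * m) E"
proof (induction q)
  case (Suc q)
  have "(z, i + Suc q * m) \<in> E \<longleftrightarrow> (z, i) \<in> E" for z i
  proof -
    have "i + Suc q * m = (i + q * m) + m" by simp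
    then show ?thesis
      using Suc assms by (simp only: period_def)
  qed
  then show ?case by (simp add: period_def)
qed (simp add: period_def)

text \<open>The Euclidean step without subtraction: going on from \<open>i + k mod m\<close> by a
  multiple of \<open>m\<close> reaches \<open>i + k\<close>, and neither that move nor the shift by
  \<open>k\<close> changes membership.\<close>

lemma period_mod:
  assumes "period m E" "period k E"
  shows "period (k mod m) E"
proof -
  have "(z, i + k mod m) \<in> E \<longleftrightarrow> (z, i) \<in> E" for z i
  proof -
    have "i + k mod m + k div m * m = i + k" by simp
    then show ?thesis
      using assms(2) period_mult[OF assms(1), of "k div m"] unfolding period_def by metis
  qed
  then show ?thesis by (simp add: period_def)
qed

text \<open>Since \<open>k\<close> is a common period, the least positive one exists. The remainder
  \<open>k mod m\<close> is a smaller common period, so minimality makes it 0.\<close>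

lemma symbol_order:
  assumes "k > 0" "frobenius_symbol k s"
  defines "m \<equiv> symbol_order k s"
  shows "period m (unroll k (fst s))" "period m (unroll k (snd s))" "m dvd k"
proof -
  let ?P = "\<lambda>m. 0 < m \<and> period m (unroll k (fst s)) \<and> period m (unroll k (snd s))"
  have m: "m = Least ?P"
    using assms symbol_order_eq by simp
  have P: "?P m"
    unfolding m by (rule LeastI[of ?P k]) (simp add: assms(1) period_unroll)
  then show "period m (unroll k (fst s))" "period m (unroll k (snd s))"
    by blast+
  have "\<not> ?P (k mod m)"
    using P unfolding m by (intro not_less_Least) simp
  then have "k mod m = 0"
    using P by (simp add: period_mod period_unroll)
  then show "m dvd k" by auto
qed

section \<open>Lifting from \<open>l\<close> to \<open>k\<close> colors\<close>

text \<open>Uniqueness of division with remainder: \<open>q\<close> and \<open>c - 1 < l\<close> are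
  the quotient and remainder of \<open>c - 1 + q * l\<close> by \<open>l\<close>.\<close>

lemma inj_on_lift:
  assumes "frobenius_row l r"
  shows "inj_on (\<lambda>((z, c), q). (z, c + q * l)) (set r \<times> Q)"
proof -
  have *: "c = c' \<and> q = q'"
    if "(z, c) \<in> set r" "(z, c') \<in> set r" and e: "c + q * l = c' + q' * l" for z c c' q q'
  proof -
    have c: "1 \<le> c" "c \<le> l" "1 \<le> c'" "c' \<le> l"
      using frobenius_row_color[OF assms] that by auto
    then obtain b b' where b: "c = Suc b" "c' = Suc b'"
      by (auto simp: Suc_le_eq gr0_conv_Suc)
    then have "(b + q * l) div l = (b' + q' * l) div l"
      using e by simp
    then have "q = q'"
      using b c by simp
    then show ?thesis using e by simp
  qed
  show ?thesis
  proof (rule inj_onI)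
    fix x y
    assume xy: "x \<in> set r \<times> Q" "y \<in> set r \<times> Q"
      "(\<lambda>((z, c), q). (z, c + q * l)) x = (\<lambda>((z, c), q). (z, c + q * l)) y"
    obtain z c q where x: "x = ((z, c), q)" by (metis surj_pair)
    obtain z' c' q' where y: "y = ((z', c'), q')" by (metis surj_pair)
    have "z = z'" using xy(3) unfolding x y by simp
    then show "x = y" using xy *[of z c c' q q'] unfolding x y by simp
  qed
qed

lemma set_lift_row:
  "set (lift_row k l r) = (\<lambda>((z, c), q). (z, c + q * l)) ` (set r \<times> {..<k div l})"
  by (simp add: lift_row_def)

lemma frobenius_row_lift_row:
  assumes "l dvd k" "frobenius_row l r"
  shows "frobenius_row k (lift_row k l r)"
proof -
  have "1 \<le> c + q * l \<and> c + q * l \<le> k" if "(z, c) \<in> set r" "q < k div l" for z c q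
  proof -
    have "c + q * l \<le> Suc q * l"
      using frobenius_row_color[OF assms(2) that(1)] by simp
    also have "\<dots> \<le> k div l * l"
      using that(2) by (intro mult_le_mono1) simp
    finally show ?thesis
      using frobenius_row_color[OF assms(2) that(1)] assms(1) by simp
  qed
  then have "\<forall>(z, c) \<in> set (lift_row k l r). 1 \<le> c \<and> c \<le> k"
    unfolding set_lift_row by fastforce
  then show ?thesis
    by (simp add: frobenius_row_def lift_row_def sorted_wrt_rev)
qed

text \<open>Dividing \<open>i mod k\<close> by \<open>l\<close> gives the number of the copy as
  quotient and, because \<open>l dvd k\<close>, the remainder \<open>i mod l\<close>.\<close>

lemma unroll_lift_row:
  assumes "k > 0" "l dvd k" "frobenius_row l r"
  shows "unroll k (lift_row k l r) = unroll l r"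
proof -
  have l: "l > 0" using assms(1,2) by (auto intro: gr0I)
  have "(z, Suc (i mod k)) \<in> set (lift_row k l r) \<longleftrightarrow> (z, Suc (i mod l)) \<in> set r" for z i
  proof
    assume "(z, Suc (i mod k)) \<in> set (lift_row k l r)"
    then obtain c q where c: "(z, c) \<in> set r" "Suc (i mod k) = c + q * l"
      by (auto simp: set_lift_row)
    then obtain b where b: "c = Suc b" "b < l"
      using frobenius_row_color[OF assms(3) c(1)] by (cases c) auto
    then have "i mod k mod l = b"
      using c(2) by simp
    then show "(z, Suc (i mod l)) \<in> set r"
      using c(1) b(1) by (simp add: mod_mod_cancel[OF assms(2)])
  next
    assume r: "(z, Suc (i mod l)) \<in> set r"
    have "i mod k div l < k div l"
      using assms(1,2) l by (simp add: less_mult_imp_div_less)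
    moreover have "Suc (i mod k) = Suc (i mod l) + (i mod k div l) * l"
      using mod_mod_cancel[OF assms(2), of i] div_mult_mod_eq[of "i mod k" l] by simp
    ultimately show "(z, Suc (i mod k)) \<in> set (lift_row k l r)"
      using r unfolding set_lift_row by force
  qed
  then show ?thesis by (auto simp: unroll_def)
qed

text \<open>Each entry has \<open>k div l\<close> distinct copies with the same integer value. A
  general \<open>f\<close> covers both parts of the weight: the constant 1 gives the length, the
  identity the sum of values.\<close>

lemma sum_lift_row:
  fixes f :: "nat \<Rightarrow> nat"
  assumes "l dvd k" "frobenius_row l r"
  shows "(\<Sum>p\<leftarrow>lift_row k l r. f (fst p)) = k div l * (\<Sum>p\<leftarrow>r. f (fst p))"
proof -
  have "(\<Sum>p\<leftarrow>lift_row k l r. f (fst p)) = (\<Sum>p\<in>set (lift_row k l r). f (fst p))"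
    using frobenius_row_lift_row[OF assms] frobenius_row_distinct sum_list_distinct_conv_sum_set
    by blast
  also have "\<dots> = (\<Sum>(p, q)\<in>set r \<times> {..<k div l}. f (fst p))"
    unfolding set_lift_row
    by (subst sum.reindex[OF inj_on_lift[OF assms(2)]]) (auto intro!: sum.cong)
  also have "\<dots> = k div l * (\<Sum>p\<in>set r. f (fst p))"
    by (simp add: sum.cartesian_product[symmetric] sum_distrib_left)
  also have "(\<Sum>p\<in>set r. f (fst p)) = (\<Sum>p\<leftarrow>r. f (fst p))"
    using frobenius_row_distinct[OF assms(2)] sum_list_distinct_conv_sum_set by metis
  finally show ?thesis .
qed

lemma length_lift_row:
  assumes "l dvd k" "frobenius_row l r"
  shows "length (lift_row k l r) = k div l * length r"
  using sum_lift_row[OF assms, of "\<lambda>_. 1"] by (simp add: sum_list_triv)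

lemma symbol_weight_lift:
  assumes "l dvd k" "frobenius_symbol l s"
  shows "symbol_weight (lift_symbol k l s) = k div l * symbol_weight s"
  using assms sum_lift_row[OF assms(1), of _ "\<lambda>z. z"] length_lift_row[OF assms(1)]
  by (simp add: symbol_weight_def lift_symbol_def frobenius_symbol_def add_mult_distrib2)

lemma frobenius_symbol_lift:
  assumes "l dvd k" "frobenius_symbol l s"
  shows "frobenius_symbol k (lift_symbol k l s)"
  using assms by (simp add: frobenius_symbol_def lift_symbol_def frobenius_row_lift_row
      length_lift_row)

text \<open>Lifting preserves the unrolled sets, and these determine the order.\<close>

lemma symbol_order_lift:
  assumes "k > 0" "l dvd k" "frobenius_symbol l s"
  shows "symbol_order k (lift_symbol k l s) = symbol_order l s"
proof -
  have "l > 0" using assms(1,2) by (auto intro: gr0I)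
  then show ?thesis
    using assms symbol_order_eq[OF assms(1) frobenius_symbol_lift[OF assms(2,3)]]
      symbol_order_eq[of l s] unroll_lift_row[OF assms(1,2)]
    by (simp add: lift_symbol_def frobenius_symbol_def)
qed

section \<open>Bijectivity of lifting\<close>

lemma inj_on_lift_symbol:
  assumes "k > 0" "l dvd k"
  shows "inj_on (lift_symbol k l) {s. frobenius_symbol l s}"
proof -
  have "r = r'" if "lift_row k l r = lift_row k l r'" "frobenius_row l r" "frobenius_row l r'"
    for r r'
    using that frobenius_row_unroll_eqI unroll_lift_row[OF assms] by metis
  then show ?thesis
    by (auto simp: inj_on_def lift_symbol_def frobenius_symbol_def)
qed

text \<open>The colors 1 to \<open>l\<close> form one full period, so keeping just those entries of
  \<open>r\<close> loses nothing: the period \<open>l\<close> restores the others.\<close>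

lemma lift_row_surj:
  assumes "k > 0" "l dvd k" "frobenius_row k r" "period l (unroll k r)"
  obtains r' where "frobenius_row l r'" "lift_row k l r' = r"
proof
  let ?r' = "filter (\<lambda>(z, c). c \<le> l) r"
  have l: "l > 0" "l \<le> k" using assms(1,2) by (auto intro: gr0I dvd_imp_le)
  show r': "frobenius_row l ?r'"
    using assms(3) by (auto simp: frobenius_row_def sorted_wrt_filter)
  have "(z, i) \<in> unroll l ?r' \<longleftrightarrow> (z, i) \<in> unroll k r" for z i
  proof -
    have "i mod l < l" using l by simp
    moreover from this have "i mod l mod k = i mod l"
      using l(2) by (meson less_le_trans mod_less)
    ultimately have "(z, i) \<in> unroll l ?r' \<longleftrightarrow> (z, i mod l) \<in> unroll k r"
      by (simp add: Suc_le_eq)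
    also have "\<dots> \<longleftrightarrow> (z, i mod l + i div l * l) \<in> unroll k r"
      using period_mult[OF assms(4), of "i div l"] unfolding period_def by blast
    finally show ?thesis by simp
  qed
  then have "unroll l ?r' = unroll k r" by auto
  then show "lift_row k l ?r' = r"
    using frobenius_row_unroll_eqI[OF frobenius_row_lift_row[OF assms(2) r'] assms(3)]
      unroll_lift_row[OF assms(1,2) r'] by simp
qed

lemma lift_symbol_surj:
  assumes "k > 0" "l dvd k" "frobenius_symbol k s" "symbol_order k s = l"
  obtains t where "frobenius_symbol l t" "lift_symbol k l t = s"
proof -
  note s = symbol_order[OF assms(1,3), unfolded assms(4)]
  have rows: "frobenius_row k (fst s)" "frobenius_row k (snd s)"
    using assms(3) by (auto simp: frobenius_symbol_def)
  obtain a where a: "frobenius_row l a" "lift_row k l a = fst s"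
    using lift_row_surj[OF assms(1,2) rows(1) s(1)] by blast
  obtain b where b: "frobenius_row l b" "lift_row k l b = snd s"
    using lift_row_surj[OF assms(1,2) rows(2) s(2)] by blast
  \<comment> \<open>The preimages of the two rows were chosen separately; their lengths agree after
    cancelling the positive factor \<open>k div l\<close>.\<close>
  have "k div l * length a = k div l * length b"
    using a b assms(3) length_lift_row[OF assms(2)] by (metis frobenius_symbol_def)
  moreover have "k div l > 0"
    using assms(1,2) by (auto elim!: dvdE)
  ultimately have "frobenius_symbol l (a, b)"
    using a b by (simp add: frobenius_symbol_def)
  moreover have "lift_symbol k l (a, b) = s"
    using a b by (simp add: lift_symbol_def)
  ultimately show ?thesis by (rule that)
qed

section \<open>Counting symbols by order\<close>

lemma card_symbols_of_order:
  assumes "k > 0" "l dvd k"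
  shows "card {s. frobenius_symbol k s \<and> symbol_weight s = n \<and> symbol_order k s = l} =
    cphi_bar l (of_nat n / (of_nat k / of_nat l))"
proof -
  let ?T = "{s. frobenius_symbol l s \<and>
    of_nat (symbol_weight s) = (of_nat n / (of_nat k / of_nat l) :: rat) \<and> symbol_order l s = l}"
  have l: "l > 0" using assms by (auto intro: gr0I)
  \<comment> \<open>Clears the rational quotient. If \<open>k div l\<close> does not divide
    \<open>n\<close>, no \<open>w\<close> satisfies either side, in line with the convention for
    non-integral arguments.\<close>
  have weight: "of_nat w = (of_nat n / (of_nat k / of_nat l) :: rat) \<longleftrightarrow> k div l * w = n" for w
  proof -
    obtain d where d: "k = l * d" using assms(2) by (rule dvdE)
    then have "d > 0" using assms(1) by simp
    then have "of_nat w = (of_nat n / (of_nat k / of_nat l) :: rat) \<longleftrightarrow>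
        of_nat (d * w) = (of_nat n :: rat)"
      using l d by (simp add: field_simps)
    then show ?thesis
      using d l by (simp only: of_nat_eq_iff) simp
  qed
  have "lift_symbol k l ` ?T =
      {s. frobenius_symbol k s \<and> symbol_weight s = n \<and> symbol_order k s = l}" (is "_ = ?S")
  proof
    show "lift_symbol k l ` ?T \<subseteq> ?S"
      unfolding weight using frobenius_symbol_lift symbol_weight_lift symbol_order_lift assms
      by auto
    show "?S \<subseteq> lift_symbol k l ` ?T"
    proof
      fix s assume s: "s \<in> ?S"
      then obtain t where t: "frobenius_symbol l t" "lift_symbol k l t = s"
        using lift_symbol_surj[OF assms] by blast
      then have "t \<in> ?T"
        unfolding weight
        using s symbol_weight_lift[OF assms(2) t(1)] symbol_order_lift[OF assms t(1)] by auto
      then show "s \<in> lift_symbol k l ` ?T" using t(2) by blast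
    qed
  qed
  moreover have "inj_on (lift_symbol k l) ?T"
    using inj_on_lift_symbol[OF assms] by (rule inj_on_subset) auto
  ultimately show ?thesis
    unfolding cphi_bar_def using card_image[of "lift_symbol k l" ?T] by simp
qed

theorem theorem7p2:
  fixes k n :: nat
  assumes "k > 0" and "n > 0"
  shows "cphi k (of_nat n) =
           (\<Sum>l | l dvd k. cphi_bar l (of_nat n / (of_nat k / of_nat l)))
       \<and> (\<Sum>l | l dvd k. cphi_bar l (of_nat n / (of_nat k / of_nat l))) =
           (\<Sum>l | l dvd k. cphi_bar (k div l) (of_nat n / of_nat l))"
proof
  let ?S = "\<lambda>l. {s. frobenius_symbol k s \<and> symbol_weight s = n \<and> symbol_order k s = l}"
  have fin: "finite (?S l)" for l
    by (rule finite_subset[OF _ finite_symbols[of k "of_nat n"]]) auto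
  \<comment> \<open>Every order divides \<open>k\<close>, so the classes \<open>?S l\<close> over
    the divisors \<open>l\<close> partition the symbols of weight \<open>n\<close>.\<close>
  have "cphi k (of_nat n) = card (\<Union>l\<in>{l. l dvd k}. ?S l)"
    unfolding cphi_def using symbol_order(3)[OF assms(1)] by (intro arg_cong[of _ _ card]) auto
  also have "\<dots> = (\<Sum>l | l dvd k. card (?S l))"
    using fin assms(1) by (intro card_UN_disjoint) auto
  also have "\<dots> = (\<Sum>l | l dvd k. cphi_bar l (of_nat n / (of_nat k / of_nat l)))"
    using card_symbols_of_order[OF assms(1)] by (intro sum.cong) auto
  finally show "cphi k (of_nat n) =
    (\<Sum>l | l dvd k. cphi_bar l (of_nat n / (of_nat k / of_nat l)))" .
  show "(\<Sum>l | l dvd k. cphi_bar l (of_nat n / (of_nat k / of_nat l))) =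
    (\<Sum>l | l dvd k. cphi_bar (k div l) (of_nat n / of_nat l))"
    \<comment> \<open>The map \<open>l\<close> to \<open>k div l\<close> is an involution on the
      divisors of \<open>k\<close>, and it turns the quotient of \<open>k\<close> by the divisor
      into the divisor itself.\<close>
    by (rule sum.reindex_bij_witness[of _ "\<lambda>l. k div l" "\<lambda>l. k div l"])
      (use assms(1) in \<open>auto elim!: dvdE\<close>)
qed

end
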